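(* Let $X$ be a pointed metric space, $E$ a reflexive Banach space, and $\alpha$ a uniform and dualizable Lipschitz cross-norm on $X\boxtimes E$. Let $\overline{\mathrm{Lip}_{0F}}(X,E^* )$ be the space of all $\alpha$-Lipschitz approximable operators from $X$ to $E^*$, that is, the closure of $\mathrm{Lip}_{0F}(X,E^* )$ in $(\mathrm{Lip}_\alpha(X,E^* ),\mathrm{Lip}_\alpha)$. Then $\left(\overline{\mathrm{Lip}_{0F}}(X,E^* ),\mathrm{Lip}_\alpha\right)$ is a Lipschitz operator Banach ideal.
   Context: $\mathbb{K}$ is $\mathbb R$ or $\mathbb C$. A pointed metric space $X$ is a metric space with metric $d$ and a designated base point $0$; a normed space is pointed by its zero vector. For pointed metric spaces $X,Y$, $\mathrm{Lip}_0(X,Y)$ is the set of base-point preserving Lipschitz maps and $\mathrm{Lip}(f)$ the least Lipschitz constant; $X^\#=\mathrm{Lip}_0(X,\mathbb K)$; $\mathcal L(E,F)$ is the space of bounded linear operators; $E^*$ is the topological dual. The Lipschitz tensor product $X\boxtimes E$ is the linear span of all linear functionals $\delta_{(x,y)}\boxtimes e$ on $\mathrm{Lip}_0(X,E^* )$ of the form $(\delta_{(x,y)}\boxtimes e)(f)=\langle f(x)-f(y),e\rangle$, for $x,y\in X$ and $e\in E$. A norm $\alpha$ on $X\boxtimes E$ is a Lipschitz cross-norm if $\alpha(\delta_{(x,y)}\boxtimes e)=d(x,y)\|e\|$ always. It is dualizable if $\left|\sum_{i=1}^n(g(x_i)-g(y_i))\langle\phi,e_i\rangle\right|\le\mathrm{Lip}(g)\|\phi\|\,\alpha\left(\sum_{i=1}^n\delta_{(x_i,y_i)}\boxtimes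 e_i\right)$ for all $g\in X^\#$, $\phi\in E^*$ and $\sum_i\delta_{(x_i,y_i)}\boxtimes e_i\in X\boxtimes E$. It is uniform if $\alpha\left(\sum_{i=1}^n\delta_{(h(x_i),h(y_i))}\boxtimes T(e_i)\right)\le\mathrm{Lip}(h)\|T\|\,\alpha\left(\sum_{i=1}^n\delta_{(x_i,y_i)}\boxtimes e_i\right)$ for all $h\in\mathrm{Lip}_0(X,X)$, $T\in\mathcal L(E,E)$ and $\sum_i\delta_{(x_i,y_i)}\boxtimes e_i\in X\boxtimes E$. A base-point preserving map $f\colon X\to E^*$ is an $\alpha$-Lipschitz operator if there is $C\ge 0$ with $\left|\sum_{i=1}^n\langle f(x_i)-f(y_i),e_i\rangle\right|\le C\,\alpha\left(\sum_{i=1}^n\delta_{(x_i,y_i)}\boxtimes e_i\right)$ for all $\sum_{i=1}^n\delta_{(x_i,y_i)}\boxtimes e_i\in X\boxtimes E$; the infimum of such $C$ is $\mathrm{Lip}_\alpha(f)$, and $\mathrm{Lip}_\alpha(X,E^* )$ is the set of all such maps, normed by $\mathrm{Lip}_\alpha$. $\mathrm{Lip}_{0F}(X,E^* )$ is the space of $f\in\mathrm{Lip}_0(X,E^* )$ for which the linear span of $f(X)$ is finite dimensional (for dualizable $\alpha$ it is contained in $\mathrm{Lip}_\alpha(X,E^* )$). A Lipschitz operator Banach ideal from $X$ to $E^*$ is a linear subspace $A(X,E^* )$ of $\mathrm{Lip}_0(X,E^* )$ with a norm $\|\cdot\|_A$ such that: (1) for all $g\in X^\#$, $\phi\in E^*$,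 the map $g\cdot\phi\colon x\mapsto g(x)\phi$ belongs to $A(X,E^* )$ and $\|g\cdot\phi\|_A\le\mathrm{Lip}(g)\|\phi\|$; (2) $(A(X,E^* ),\|\cdot\|_A)$ is a Banach space; (3) if $f\in A(X,E^* )$, $h\in\mathrm{Lip}_0(X,X)$ and $S\in\mathcal L(E^*,E^* )$, then $Sfh\in A(X,E^* )$ and $\|Sfh\|_A\le\|S\|\|f\|_A\mathrm{Lip}(h)$. *)

theory Defs
  imports "HOL-Analysis.Analysis" "HOL-Library.Function_Algebras"
begin

(* The scalar field K: a normed field isometrically isomorphic to the reals or to the
   complex numbers.  Both types are instances, so a statement over 'k :: rc_field covers
   exactly the two cases. *)

class rc_field = real_normed_field +
  assumes real_or_complex:
    "(\<exists>\<psi> :: 'a \<Rightarrow> real. bij \<psi> \<and> (\<forall>x y. \<psi> (x + y) = \<psi> x + \<psi> y) \<and>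
        (\<forall>x y. \<psi> (x * y) = \<psi> x * \<psi> y) \<and> (\<forall>x. norm (\<psi> x) = norm x)) \<or>
     (\<exists>\<psi> :: 'a \<Rightarrow> complex. bij \<psi> \<and> (\<forall>x y. \<psi> (x + y) = \<psi> x + \<psi> y) \<and>
        (\<forall>x y. \<psi> (x * y) = \<psi> x * \<psi> y) \<and> (\<forall>x. norm (\<psi> x) = norm x))"

instance real :: rc_field
  by standard (intro disjI1 exI[of _ id], simp)

instance complex :: rc_field
  by standard (intro disjI2 exI[of _ id], simp)

(* A Banach space over K: the type class supplies the norm, completeness and the underlying
   real structure, sc is the multiplication by scalars from K. *)

locale banach_over = vector_space sc
  for sc :: "'k::rc_field \<Rightarrow> 'e::banach \<Rightarrow> 'e" +
  assumes sc_of_real: "sc (of_real r) v = r *\<^sub>R v"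
    and norm_sc: "norm (sc c v) = norm c * norm v"

(* The dual E* is the set of K-linear elements of the type of bounded real-linear maps from
   E to K; the norm of that type is the operator norm. *)

definition dual :: "('k::rc_field \<Rightarrow> 'e::banach \<Rightarrow> 'e) \<Rightarrow> ('e \<Rightarrow>\<^sub>L 'k) set" where
  "dual sc = {\<phi>. Vector_Spaces.linear sc (*) (blinfun_apply \<phi>)}"

definition dual_sc :: "'k::rc_field \<Rightarrow> ('e::banach \<Rightarrow>\<^sub>L 'k) \<Rightarrow> ('e \<Rightarrow>\<^sub>L 'k)" where
  "dual_sc c \<phi> = blinfun_mult_right c o\<^sub>L \<phi>"

lemma dual_sc_apply [simp]: "blinfun_apply (dual_sc c \<phi>) e = c * blinfun_apply \<phi> e"
  by (simp add: dual_sc_def)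

lemma vector_space_dual_sc: "vector_space dual_sc"
  by unfold_locales (auto intro!: blinfun_eqI simp: algebra_simps blinfun.add_left)

(* Bounded K-linear maps out of E*.  Only their values on dual sc matter. *)

definition bounded_linear_dual ::
  "('k::rc_field \<Rightarrow> 'e::banach \<Rightarrow> 'e) \<Rightarrow> ('k \<Rightarrow> 'w \<Rightarrow> 'w) \<Rightarrow>
    (('e \<Rightarrow>\<^sub>L 'k) \<Rightarrow> 'w::real_normed_vector) \<Rightarrow> bool" where
  "bounded_linear_dual sc scw T \<longleftrightarrow>
     (\<forall>\<phi>\<in>dual sc. \<forall>\<psi>\<in>dual sc. T (\<phi> + \<psi>) = T \<phi> + T \<psi>) \<and>
     (\<forall>c. \<forall>\<phi>\<in>dual sc. T (dual_sc c \<phi>) = scw c (T \<phi>)) \<and>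
     (\<exists>C. \<forall>\<phi>\<in>dual sc. norm (T \<phi>) \<le> C * norm \<phi>)"

definition opnorm_dual ::
  "('k::rc_field \<Rightarrow> 'e::banach \<Rightarrow> 'e) \<Rightarrow> (('e \<Rightarrow>\<^sub>L 'k) \<Rightarrow> 'w::real_normed_vector) \<Rightarrow> real" where
  "opnorm_dual sc T = Inf {C. 0 \<le> C \<and> (\<forall>\<phi>\<in>dual sc. norm (T \<phi>) \<le> C * norm \<phi>)}"

(* The canonical map from E into its bidual is onto. *)

definition reflexive :: "('k::rc_field \<Rightarrow> 'e::banach \<Rightarrow> 'e) \<Rightarrow> bool" where
  "reflexive sc \<longleftrightarrow>
     (\<forall>\<Phi> :: ('e \<Rightarrow>\<^sub>L 'k) \<Rightarrow> 'k. bounded_linear_dual sc (*) \<Phi> \<longrightarrow>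
        (\<exists>e. \<forall>\<phi>\<in>dual sc. \<Phi> \<phi> = blinfun_apply \<phi> e))"

definition lip0 :: "'x::metric_space \<Rightarrow> 'y::metric_space \<Rightarrow> ('x \<Rightarrow> 'y) set" where
  "lip0 x0 y0 = {f. f x0 = y0 \<and> (\<exists>L. L-lipschitz_on UNIV f)}"

definition Lip :: "('x::metric_space \<Rightarrow> 'y::metric_space) \<Rightarrow> real" where
  "Lip f = Inf {L. L-lipschitz_on UNIV f}"

definition lip0_dual ::
  "'x::metric_space \<Rightarrow> ('k::rc_field \<Rightarrow> 'e::banach \<Rightarrow> 'e) \<Rightarrow> ('x \<Rightarrow> 'e \<Rightarrow>\<^sub>L 'k) set" where
  "lip0_dual x0 sc = {f \<in> lip0 x0 0. range f \<subseteq> dual sc}"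

(* Scalar multiplication on maps from X to E*; addition is pointwise, from Function_Algebras. *)

definition fun_sc :: "'k::rc_field \<Rightarrow> ('x \<Rightarrow> 'e::banach \<Rightarrow>\<^sub>L 'k) \<Rightarrow> ('x \<Rightarrow> 'e \<Rightarrow>\<^sub>L 'k)" where
  "fun_sc c f = (\<lambda>x. dual_sc c (f x))"

(* Functionals on Lip_0(X,E* ) are total HOL functions that vanish outside Lip_0(X,E* ), so that
   equality of functionals is equality on Lip_0(X,E* ). *)

type_synonym ('x, 'e, 'k) lip_functional = "('x \<Rightarrow> 'e \<Rightarrow>\<^sub>L 'k) \<Rightarrow> 'k"

definition delta ::
  "'x::metric_space \<Rightarrow> ('k::rc_field \<Rightarrow> 'e::banach \<Rightarrow> 'e) \<Rightarrow> 'x \<Rightarrow> 'x \<Rightarrow> 'e \<Rightarrow>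
    ('x, 'e, 'k) lip_functional" where
  "delta x0 sc x y e = (\<lambda>f. if f \<in> lip0_dual x0 sc then blinfun_apply (f x - f y) e else 0)"

definition functional_sc ::
  "'k::rc_field \<Rightarrow> ('x::metric_space, 'e::banach, 'k) lip_functional \<Rightarrow>
    ('x, 'e, 'k) lip_functional" where
  "functional_sc c u = (\<lambda>f. c * u f)"

definition lip_tensor ::
  "'x::metric_space \<Rightarrow> ('k::rc_field \<Rightarrow> 'e::banach \<Rightarrow> 'e) \<Rightarrow> ('x, 'e, 'k) lip_functional set" where
  "lip_tensor x0 sc = module.span functional_sc {delta x0 sc x y e | x y e. True}"

definition norm_over ::
  "('k::rc_field \<Rightarrow> 'v \<Rightarrow> 'v) \<Rightarrow> 'v::ab_group_add set \<Rightarrow> ('v \<Rightarrow> real) \<Rightarrow> bool" where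
  "norm_over scv V N \<longleftrightarrow>
     (\<forall>v\<in>V. 0 \<le> N v) \<and> (\<forall>v\<in>V. N v = 0 \<longleftrightarrow> v = 0) \<and>
     (\<forall>c. \<forall>v\<in>V. N (scv c v) = norm c * N v) \<and>
     (\<forall>v\<in>V. \<forall>w\<in>V. N (v + w) \<le> N v + N w)"

definition complete_norm :: "'v::ab_group_add set \<Rightarrow> ('v \<Rightarrow> real) \<Rightarrow> bool" where
  "complete_norm V N \<longleftrightarrow>
     (\<forall>s :: nat \<Rightarrow> 'v. range s \<subseteq> V \<and> (\<forall>\<epsilon>>0. \<exists>M. \<forall>m\<ge>M. \<forall>n\<ge>M. N (s m - s n) < \<epsilon>) \<longrightarrow>
        (\<exists>v\<in>V. (\<lambda>n. N (s n - v)) \<longlonglongrightarrow> 0))"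

definition lip_crossnorm ::
  "'x::metric_space \<Rightarrow> ('k::rc_field \<Rightarrow> 'e::banach \<Rightarrow> 'e) \<Rightarrow>
    (('x, 'e, 'k) lip_functional \<Rightarrow> real) \<Rightarrow> bool" where
  "lip_crossnorm x0 sc \<alpha> \<longleftrightarrow>
     norm_over functional_sc (lip_tensor x0 sc) \<alpha> \<and>
     (\<forall>x y e. \<alpha> (delta x0 sc x y e) = dist x y * norm e)"

definition dualizable ::
  "'x::metric_space \<Rightarrow> ('k::rc_field \<Rightarrow> 'e::banach \<Rightarrow> 'e) \<Rightarrow>
    (('x, 'e, 'k) lip_functional \<Rightarrow> real) \<Rightarrow> bool" where
  "dualizable x0 sc \<alpha> \<longleftrightarrow>
     (\<forall>g \<in> lip0 x0 (0::'k). \<forall>\<phi> \<in> dual sc. \<forall>(n::nat) x y e.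
        norm (\<Sum>i<n. (g (x i) - g (y i)) * blinfun_apply \<phi> (e i))
          \<le> Lip g * norm \<phi> * \<alpha> (\<Sum>i<n. delta x0 sc (x i) (y i) (e i)))"

definition uniform ::
  "'x::metric_space \<Rightarrow> ('k::rc_field \<Rightarrow> 'e::banach \<Rightarrow> 'e) \<Rightarrow>
    (('x, 'e, 'k) lip_functional \<Rightarrow> real) \<Rightarrow> bool" where
  "uniform x0 sc \<alpha> \<longleftrightarrow>
     (\<forall>h \<in> lip0 x0 x0. \<forall>T :: 'e \<Rightarrow>\<^sub>L 'e. Vector_Spaces.linear sc sc (blinfun_apply T) \<longrightarrow>
       (\<forall>(n::nat) x y e.
          \<alpha> (\<Sum>i<n. delta x0 sc (h (x i)) (h (y i)) (blinfun_apply T (e i)))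
            \<le> Lip h * norm T * \<alpha> (\<Sum>i<n. delta x0 sc (x i) (y i) (e i))))"

definition alpha_bound ::
  "'x::metric_space \<Rightarrow> ('k::rc_field \<Rightarrow> 'e::banach \<Rightarrow> 'e) \<Rightarrow>
    (('x, 'e, 'k) lip_functional \<Rightarrow> real) \<Rightarrow> ('x \<Rightarrow> 'e \<Rightarrow>\<^sub>L 'k) \<Rightarrow> real \<Rightarrow> bool" where
  "alpha_bound x0 sc \<alpha> f C \<longleftrightarrow> 0 \<le> C \<and>
     (\<forall>(n::nat) x y e.
        norm (\<Sum>i<n. blinfun_apply (f (x i) - f (y i)) (e i))
          \<le> C * \<alpha> (\<Sum>i<n. delta x0 sc (x i) (y i) (e i)))"

definition Lip_alpha_ops ::
  "'x::metric_space \<Rightarrow> ('k::rc_field \<Rightarrow> 'e::banach \<Rightarrow> 'e) \<Rightarrow>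
    (('x, 'e, 'k) lip_functional \<Rightarrow> real) \<Rightarrow> ('x \<Rightarrow> 'e \<Rightarrow>\<^sub>L 'k) set" where
  "Lip_alpha_ops x0 sc \<alpha> =
     {f. f x0 = 0 \<and> range f \<subseteq> dual sc \<and> (\<exists>C. alpha_bound x0 sc \<alpha> f C)}"

definition Lip_alpha ::
  "'x::metric_space \<Rightarrow> ('k::rc_field \<Rightarrow> 'e::banach \<Rightarrow> 'e) \<Rightarrow>
    (('x, 'e, 'k) lip_functional \<Rightarrow> real) \<Rightarrow> ('x \<Rightarrow> 'e \<Rightarrow>\<^sub>L 'k) \<Rightarrow> real" where
  "Lip_alpha x0 sc \<alpha> f = Inf {C. alpha_bound x0 sc \<alpha> f C}"

definition lip0F ::
  "'x::metric_space \<Rightarrow> ('k::rc_field \<Rightarrow> 'e::banach \<Rightarrow> 'e) \<Rightarrow> ('x \<Rightarrow> 'e \<Rightarrow>\<^sub>L 'k) set" where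
  "lip0F x0 sc = {f \<in> lip0_dual x0 sc.
     \<exists>B. finite B \<and> module.span dual_sc (range f) = module.span dual_sc B}"

(* For dualizable \<alpha> the finite-dimensional-rank maps all lie in Lip_alpha_ops; the intersection
   makes the closure meaningful without that fact. *)

definition Lip_alpha_approximable ::
  "'x::metric_space \<Rightarrow> ('k::rc_field \<Rightarrow> 'e::banach \<Rightarrow> 'e) \<Rightarrow>
    (('x, 'e, 'k) lip_functional \<Rightarrow> real) \<Rightarrow> ('x \<Rightarrow> 'e \<Rightarrow>\<^sub>L 'k) set" where
  "Lip_alpha_approximable x0 sc \<alpha> =
     {f \<in> Lip_alpha_ops x0 sc \<alpha>.
        \<forall>\<epsilon>>0. \<exists>g \<in> lip0F x0 sc \<inter> Lip_alpha_ops x0 sc \<alpha>. Lip_alpha x0 sc \<alpha> (f - g) < \<epsilon>}"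

definition lip_operator_banach_ideal ::
  "'x::metric_space \<Rightarrow> ('k::rc_field \<Rightarrow> 'e::banach \<Rightarrow> 'e) \<Rightarrow>
    ('x \<Rightarrow> 'e \<Rightarrow>\<^sub>L 'k) set \<Rightarrow> (('x \<Rightarrow> 'e \<Rightarrow>\<^sub>L 'k) \<Rightarrow> real) \<Rightarrow> bool" where
  "lip_operator_banach_ideal x0 sc A N \<longleftrightarrow>
     A \<subseteq> lip0_dual x0 sc \<and> module.subspace fun_sc A \<and>
     norm_over fun_sc A N \<and> complete_norm A N \<and>
     (\<forall>g \<in> lip0 x0 (0::'k). \<forall>\<phi> \<in> dual sc.
        (\<lambda>x. dual_sc (g x) \<phi>) \<in> A \<and> N (\<lambda>x. dual_sc (g x) \<phi>) \<le> Lip g * norm \<phi>) \<and>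
     (\<forall>f \<in> A. \<forall>h \<in> lip0 x0 x0. \<forall>S.
        bounded_linear_dual sc dual_sc S \<and> S ` dual sc \<subseteq> dual sc \<longrightarrow>
        S \<circ> f \<circ> h \<in> A \<and> N (S \<circ> f \<circ> h) \<le> opnorm_dual sc S * N f * Lip h)"

lemma vector_space_fun_sc: "vector_space fun_sc"
  by unfold_locales
    (auto intro!: ext blinfun_eqI simp: fun_sc_def algebra_simps blinfun.add_left blinfun.add_right)

lemma vector_space_functional_sc: "vector_space functional_sc"
  by unfold_locales (auto intro!: ext simp: functional_sc_def algebra_simps)

end

theory Submission
  imports Defs
begin

text \<open>
  Everything is driven by the \<open>\<alpha>\<close>-bounds of a map \<open>f\<close>: the constants \<open>C\<close> with
  \<open>\<bar>\<Sum>\<^sub>i \<langle>f x\<^sub>i - f y\<^sub>i, e\<^sub>i\<rangle>\<bar> \<le> C \<alpha>(\<Sum>\<^sub>i \<delta>(x\<^sub>i, y\<^sub>i) \<box> e\<^sub>i)\<close>.  The least one is attained and equals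
  \<open>Lip_alpha f\<close>, so each inequality about \<open>Lip_alpha\<close> reduces to exhibiting a bound.  Tested on a
  single elementary tensor, the cross-norm identity shows that an \<open>\<alpha>\<close>-bound is also a Lipschitz
  constant.  Hence the \<open>\<alpha>\<close>-Lipschitz operators form a normed space of Lipschitz maps, and a Cauchy
  sequence in it converges pointwise; since an \<open>\<alpha>\<close>-bound is a family of inequalities between finite
  sums, it survives this limit, which gives completeness (\<open>ops_limit\<close>).  The approximable operators
  are a closed subspace and so are complete as well.  The maps \<open>g \<cdot> \<phi>\<close> have rank at most one, and
  their norm estimate is what dualizability says.

  The ideal property uses reflexivity.  A bounded operator \<open>S\<close> on \<open>E\<^sup>*\<close> is then the adjoint of a
  bounded operator \<open>T\<close> on \<open>E\<close> with \<open>\<parallel>T\<parallel> \<le> \<parallel>S\<parallel>\<close> (\<open>adjoint_exists\<close>), because each functional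
  \<open>\<phi> \<mapsto> \<langle>S \<phi>, e\<rangle>\<close> on \<open>E\<^sup>*\<close> is evaluation at a point \<open>T e\<close>.  Therefore
  \<open>\<langle>S f h x - S f h y, e\<rangle> = \<langle>f (h x) - f (h y), T e\<rangle>\<close>, and uniformity of \<open>\<alpha>\<close> applied to \<open>h\<close> and \<open>T\<close>
  gives the bound \<open>\<parallel>S\<parallel> Lip_alpha f Lip h\<close> (\<open>alpha_bound_comp\<close>).  The same estimate for \<open>f - g\<close>
  shows that composition preserves approximability by maps of finite rank.

  Linearity of \<open>T\<close> and the bound on its norm need enough functionals on \<open>E\<close>, that is, the
  Hahn-Banach theorem for norming functionals.  The real case comes from the fact that minimal
  sublinear functionals are linear; the complex case follows by recovering a complex functional
  from its real part.
\<close>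

section \<open>Norming functionals\<close>

definition sublinear :: "('a::real_vector \<Rightarrow> real) \<Rightarrow> bool" where
  "sublinear p \<longleftrightarrow>
     (\<forall>x y. p (x + y) \<le> p x + p y) \<and> (\<forall>t x. 0 \<le> t \<longrightarrow> p (t *\<^sub>R x) \<le> t * p x)"

lemma sublinear_add: "sublinear p \<Longrightarrow> p (x + y) \<le> p x + p y"
  and sublinear_scale_le: "sublinear p \<Longrightarrow> 0 \<le> t \<Longrightarrow> p (t *\<^sub>R x) \<le> t * p x"
  by (auto simp: sublinear_def)

lemma sublinear_zero: "sublinear p \<Longrightarrow> p 0 = 0"
  using sublinear_add[of p 0 0] sublinear_scale_le[of p 0 0] by simp

lemma sublinear_minus: "sublinear p \<Longrightarrow> - p (- x) \<le> p x"
  using sublinear_add[of p x "- x"] sublinear_zero[of p] by simp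

lemma sublinear_scale:
  assumes "sublinear p" "0 \<le> t"
  shows "p (t *\<^sub>R x) = t * p x"
proof (cases "t = 0")
  case True
  then show ?thesis using sublinear_zero[OF assms(1)] by simp
next
  case False
  with assms have t: "0 < t" by simp
  have "p ((1 / t) *\<^sub>R (t *\<^sub>R x)) \<le> (1 / t) * p (t *\<^sub>R x)"
    using t by (intro sublinear_scale_le assms) simp
  then have "t * p x \<le> p (t *\<^sub>R x)" using t by (simp add: field_simps)
  with sublinear_scale_le[OF assms] show ?thesis by (rule antisym)
qed

text \<open>
  The greatest sublinear functional below \<open>p\<close> whose value at \<open>- y\<close> is at most \<open>- p y\<close>.  It serves
  twice: starting from the norm it forces a functional to attain the norm at \<open>y\<close>, and applied to a
  minimal sublinear functional it yields additivity.
\<close>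

definition tilt :: "('a::real_vector \<Rightarrow> real) \<Rightarrow> 'a \<Rightarrow> 'a \<Rightarrow> real" where
  "tilt p y x = (INF t\<in>{0..}. p (x + t *\<^sub>R y) - t * p y)"

lemma tilt_le:
  assumes "sublinear p" "0 \<le> t"
  shows "tilt p y x \<le> p (x + t *\<^sub>R y) - t * p y"
proof -
  have "- p (- x) \<le> p (x + s *\<^sub>R y) - s * p y" if "0 \<le> s" for s
    using sublinear_add[OF assms(1), of "x + s *\<^sub>R y" "- x"] sublinear_scale[OF assms(1) that, of y]
    by simp
  then have "bdd_below ((\<lambda>t. p (x + t *\<^sub>R y) - t * p y) ` {0..})"
    by (auto intro!: bdd_belowI2)
  then show ?thesis
    unfolding tilt_def using assms(2) by (intro cINF_lower) auto
qed

lemma tilt_greatest: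
  assumes "\<And>t. 0 \<le> t \<Longrightarrow> c \<le> p (x + t *\<^sub>R y) - t * p y"
  shows "c \<le> tilt p y x"
  unfolding tilt_def using assms by (intro cINF_greatest) auto

lemma sublinear_tilt:
  assumes p: "sublinear p"
  shows "sublinear (tilt p y)"
  unfolding sublinear_def
proof (intro conjI allI impI)
  fix x z
  \<comment> \<open>Parameters \<open>s\<close> and \<open>t\<close> for the summands combine to the parameter \<open>s + t\<close> for the sum.\<close>
  have *: "tilt p y (x + z) \<le> (p (x + s *\<^sub>R y) - s * p y) + (p (z + t *\<^sub>R y) - t * p y)"
    if "0 \<le> s" "0 \<le> t" for s t
    using tilt_le[OF p, of "s + t" y "x + z"] sublinear_add[OF p, of "x + s *\<^sub>R y" "z + t *\<^sub>R y"] that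
    by (simp add: algebra_simps)
  have "tilt p y (x + z) - (p (x + s *\<^sub>R y) - s * p y) \<le> tilt p y z" if "0 \<le> s" for s
    using *[OF that] by (intro tilt_greatest) (simp add: algebra_simps)
  then have "tilt p y (x + z) - tilt p y z \<le> tilt p y x"
    by (intro tilt_greatest) (simp add: algebra_simps)
  then show "tilt p y (x + z) \<le> tilt p y x + tilt p y z" by simp
next
  fix c x assume c: "(0::real) \<le> c"
  show "tilt p y (c *\<^sub>R x) \<le> c * tilt p y x"
  proof (cases "c = 0")
    case True
    then show ?thesis using tilt_le[OF p, of 0 y 0] sublinear_zero[OF p] by simp
  next
    case False
    with c have c: "0 < c" by simp
    have "tilt p y (c *\<^sub>R x) / c \<le> p (x + t *\<^sub>R y) - t * p y" if t: "0 \<le> t" for t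
    proof -
      have "tilt p y (c *\<^sub>R x) \<le> p (c *\<^sub>R (x + t *\<^sub>R y)) - (c * t) * p y"
        using tilt_le[OF p, of "c * t" y "c *\<^sub>R x"] c t by (simp add: algebra_simps)
      also have "\<dots> = c * (p (x + t *\<^sub>R y) - t * p y)"
        using c by (subst sublinear_scale[OF p]) (simp_all add: algebra_simps)
      finally show ?thesis using c by (simp add: field_simps)
    qed
    then have "tilt p y (c *\<^sub>R x) / c \<le> tilt p y x" by (rule tilt_greatest)
    then show ?thesis using c by (simp add: field_simps)
  qed
qed

text \<open>
  Zorn's lemma for the reversed order: the pointwise infimum of a chain of sublinear functionals
  below \<open>p\<close> is finite since each of them is bounded below at \<open>x\<close> by \<open>- p (- x)\<close>, and it is
  subadditive because two members of a chain can be replaced by the smaller one.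
\<close>

lemma minimal_sublinear_exists:
  assumes p: "sublinear p"
  obtains q where "sublinear q" "q \<le> p" "\<And>r. sublinear r \<Longrightarrow> r \<le> q \<Longrightarrow> r = q"
proof -
  define A where "A = {q. sublinear q \<and> q \<le> p}"
  have "\<exists>m\<in>A. \<forall>a\<in>A. a \<le> m \<longrightarrow> a = m"
  proof (rule predicate_Zorn)
    show "partial_order_on A (relation_of (\<lambda>x y. y \<le> x) A)"
      by (rule partial_order_on_relation_ofI) auto
  next
    fix C assume C: "C \<in> Chains (relation_of (\<lambda>x y. y \<le> x) A)"
    then have CA: "C \<subseteq> A" and tot: "\<And>q r. q \<in> C \<Longrightarrow> r \<in> C \<Longrightarrow> q \<le> r \<or> r \<le> q"
      by (auto simp: Chains_def relation_of_def)
    show "\<exists>u\<in>A. \<forall>a\<in>C. u \<le> a"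
    proof (cases "C = {}")
      case True
      then show ?thesis using p by (auto simp: A_def)
    next
      case False
      define u where "u = (\<lambda>x. INF q\<in>C. q x)"
      have "- p (- x) \<le> q x" if "q \<in> C" for q x
      proof -
        have "sublinear q" "q (- x) \<le> p (- x)" using that CA by (auto simp: A_def le_fun_def)
        then show ?thesis using sublinear_minus[of q x] by linarith
      qed
      then have u_le: "u x \<le> q x" if "q \<in> C" for q x
        unfolding u_def using that by (intro cINF_lower bdd_belowI2) auto
      have u_ge: "c \<le> u x" if "\<And>q. q \<in> C \<Longrightarrow> c \<le> q x" for c x
        unfolding u_def using False that by (intro cINF_greatest) auto
      have "sublinear u"
        unfolding sublinear_def
      proof (intro conjI allI impI)
        fix x z
        have *: "u (x + z) \<le> q x + r z" if "q \<in> C" "r \<in> C" for q r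
        proof -
          have "\<exists>m\<in>C. m \<le> q \<and> m \<le> r" using tot[OF that] that by blast
          then obtain m where m: "m \<in> C" "m \<le> q" "m \<le> r" by blast
          have "u (x + z) \<le> m (x + z)" by (rule u_le[OF m(1)])
          also have "\<dots> \<le> m x + m z" using m(1) CA by (intro sublinear_add) (auto simp: A_def)
          also have "\<dots> \<le> q x + r z" using m(2,3) by (intro add_mono) (auto simp: le_fun_def)
          finally show ?thesis .
        qed
        have "u (x + z) - q x \<le> u z" if "q \<in> C" for q
          using *[OF that] by (intro u_ge) (simp add: algebra_simps)
        then have "u (x + z) - u z \<le> u x"
          by (intro u_ge) (simp add: algebra_simps)
        then show "u (x + z) \<le> u x + u z" by simp
      next
        fix t x assume t: "(0::real) \<le> t"
        show "u (t *\<^sub>R x) \<le> t * u x"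
        proof (cases "t = 0")
          case True
          obtain q where "q \<in> C" using False by blast
          then have "u 0 \<le> q 0" "sublinear q" using u_le CA by (auto simp: A_def)
          then show ?thesis using True sublinear_zero[of q] by simp
        next
          case tn: False
          have "u (t *\<^sub>R x) / t \<le> q x" if "q \<in> C" for q
          proof -
            have "u (t *\<^sub>R x) \<le> q (t *\<^sub>R x)" by (rule u_le[OF that])
            also have "\<dots> \<le> t * q x" using that CA t by (intro sublinear_scale_le) (auto simp: A_def)
            finally show ?thesis using t tn by (simp add: field_simps)
          qed
          then have "u (t *\<^sub>R x) / t \<le> u x" by (rule u_ge)
          then show ?thesis using t tn by (simp add: field_simps)
        qed
      qed
      moreover have "u \<le> p"
      proof -
        obtain q where "q \<in> C" using False by blast
        then have "u \<le> q" "q \<le> p" using u_le CA by (auto simp: A_def le_fun_def)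
        then show ?thesis by (rule order_trans)
      qed
      ultimately show ?thesis using u_le by (auto simp: A_def le_fun_def)
    qed
  qed
  then obtain m where m: "m \<in> A" "\<forall>a\<in>A. a \<le> m \<longrightarrow> a = m" by blast
  show thesis
  proof
    show "sublinear m" "m \<le> p" using m(1) by (auto simp: A_def)
    show "r = m" if "sublinear r" "r \<le> m" for r
      using m that order_trans[of r m p] by (auto simp: A_def)
  qed
qed

text \<open>
  A minimal \<open>q\<close> equals its tilt in every direction \<open>y\<close>, and the parameter \<open>t = 1\<close> in the infimum
  defining the tilt gives superadditivity \<open>q x + q y \<le> q (x + y)\<close>.
\<close>

lemma minimal_sublinear_linear:
  assumes q: "sublinear q" and min: "\<And>r. sublinear r \<Longrightarrow> r \<le> q \<Longrightarrow> r = q"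
  shows "linear q"
proof -
  have add: "q (x + y) = q x + q y" for x y
  proof (rule antisym)
    have "tilt q y \<le> q" using tilt_le[OF q, of 0 y] by (auto simp: le_fun_def)
    then have "tilt q y = q" by (intro min sublinear_tilt q)
    then show "q x + q y \<le> q (x + y)" using tilt_le[OF q, of 1 y x] by simp
  qed (rule sublinear_add[OF q])
  have neg: "q (- x) = - q x" for x
    using add[of x "- x"] sublinear_zero[OF q] by simp
  show ?thesis
  proof (rule linearI)
    show "q (x + y) = q x + q y" for x y by (rule add)
    show "q (t *\<^sub>R x) = t *\<^sub>R q x" for t x
      using sublinear_scale[OF q, of t x] sublinear_scale[OF q, of "- t" x] neg[of "t *\<^sub>R x"]
      by (cases "0 \<le> t") auto
  qed
qed

text \<open>
  A minimal sublinear functional below the norm tilted at \<open>a\<close>: the value at \<open>- a\<close> is at most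
  \<open>- norm a\<close>, so by linearity the value at \<open>a\<close> is at least \<open>norm a\<close>.
\<close>

lemma real_norming_functional:
  fixes a :: "'a::real_normed_vector"
  obtains u :: "'a \<Rightarrow> real" where "linear u" "\<And>x. u x \<le> norm x" "u a = norm a"
proof -
  have n: "sublinear (norm :: 'a \<Rightarrow> real)"
    by (simp add: sublinear_def norm_triangle_ineq)
  obtain u where u: "sublinear u" "u \<le> tilt norm a" "\<And>r. sublinear r \<Longrightarrow> r \<le> u \<Longrightarrow> r = u"
    by (rule minimal_sublinear_exists[OF sublinear_tilt[OF n, of a]]) blast
  show thesis
  proof
    show lin: "linear u" using u(1,3) by (rule minimal_sublinear_linear)
    show le: "u x \<le> norm x" for x
      using u(2) tilt_le[OF n, of 0 a x] by (auto simp: le_fun_def intro: order_trans)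
    have "u (- a) \<le> - norm a"
      using u(2) tilt_le[OF n, of 1 a "- a"] by (auto simp: le_fun_def intro: order_trans)
    then show "u a = norm a" using le[of a] linear_neg[OF lin, of a] by simp
  qed
qed

text \<open>
  This makes an element \<open>j\<close> playing the role of \<open>\<i>\<close> available inside the scalar field itself, so
  that functionals can be built without transporting them along the isomorphism.  The
  isomorphism fixes the reals because \<open>r\<close> is the only point at distance \<open>\<bar>r\<bar>\<close> from 0 and
  \<open>\<bar>r - 1\<bar>\<close> from 1.
\<close>

lemma rc_field_cases:
  obtains (real) "\<And>c::'k::rc_field. \<exists>a. c = of_real a"
  | (complex) j :: "'k::rc_field" where "j * j = - 1" "\<And>c::'k::rc_field. \<exists>a b. c = of_real a + of_real b * j"
      "\<And>a b. norm (of_real a + of_real b * j) = sqrt (a\<^sup>2 + b\<^sup>2)"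
proof -
  consider
    (R) \<psi> :: "'k \<Rightarrow> real" where "bij \<psi>" "\<And>x y. \<psi> (x + y) = \<psi> x + \<psi> y"
        "\<And>x y. \<psi> (x * y) = \<psi> x * \<psi> y" "\<And>x. norm (\<psi> x) = norm x"
  | (C) \<psi> :: "'k \<Rightarrow> complex" where "bij \<psi>" "\<And>x y. \<psi> (x + y) = \<psi> x + \<psi> y"
        "\<And>x y. \<psi> (x * y) = \<psi> x * \<psi> y" "\<And>x. norm (\<psi> x) = norm x"
    using real_or_complex by blast
  then show thesis
  proof cases
    case R
    have inj: "x = y" if "\<psi> x = \<psi> y" for x y using R(1) that by (auto dest: bij_is_inj injD)
    have one: "\<psi> 1 = 1" using R(3)[of 1 1] R(4)[of 1] by auto
    have diff: "\<psi> (x - y) = \<psi> x - \<psi> y" for x y using R(2)[of "x - y" y] by simp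
    have *: "\<psi> (of_real r) = r" for r
    proof -
      have "\<bar>\<psi> (of_real r)\<bar> = \<bar>r\<bar>" "\<bar>\<psi> (of_real r) - 1\<bar> = \<bar>r - 1\<bar>"
        using R(4)[of "of_real r"] R(4)[of "of_real (r - 1)"] norm_of_real[of "r - 1", where 'a = 'k]
        by (simp_all add: diff one)
      then show ?thesis by linarith
    qed
    have "c = of_real (\<psi> c)" for c by (rule inj) (simp add: *)
    then show thesis by (intro real) blast
  next
    case C
    have inj: "x = y" if "\<psi> x = \<psi> y" for x y using C(1) that by (auto dest: bij_is_inj injD)
    have one: "\<psi> 1 = 1" using C(3)[of 1 1] C(4)[of 1] by auto
    have diff: "\<psi> (x - y) = \<psi> x - \<psi> y" for x y using C(2)[of "x - y" y] by simp
    have *: "\<psi> (of_real r) = of_real r" for r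
    proof -
      let ?z = "\<psi> (of_real r)"
      have "(cmod ?z)\<^sup>2 = r\<^sup>2" "(cmod (?z - 1))\<^sup>2 = (r - 1)\<^sup>2"
        using C(4)[of "of_real r"] C(4)[of "of_real (r - 1)"] norm_of_real[of "r - 1", where 'a = 'k]
        by (simp_all add: diff one)
      then have "(Re ?z)\<^sup>2 + (Im ?z)\<^sup>2 = r\<^sup>2" "(Re ?z - 1)\<^sup>2 + (Im ?z)\<^sup>2 = (r - 1)\<^sup>2"
        by (simp_all add: cmod_power2)
      then have "Re ?z = r" "Im ?z = 0" by (auto simp: power2_eq_square algebra_simps)
      then show ?thesis by (simp add: complex_eq_iff)
    qed
    obtain j where j: "\<psi> j = \<i>" using C(1) by (metis bij_pointE)
    have \<psi>: "\<psi> (of_real a + of_real b * j) = Complex a b" for a b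
      by (simp add: C(2,3) * j complex_eq_iff)
    show thesis
    proof (rule complex)
      show "j * j = - 1"
        using C(3)[of j j] diff[of 0 1] diff[of 0 0] by (intro inj) (simp add: j one)
      show "\<exists>a b. c = of_real a + of_real b * j" for c
        by (intro exI[of _ "Re (\<psi> c)"] exI[of _ "Im (\<psi> c)"] inj) (simp add: \<psi>)
      show "norm (of_real a + of_real b * j) = sqrt (a\<^sup>2 + b\<^sup>2)" for a b
        using C(4)[of "of_real a + of_real b * j"] by (simp add: \<psi> cmod_def)
    qed
  qed
qed

lemma complete_space_isometry:
  fixes \<psi> :: "'a::metric_space \<Rightarrow> 'b::complete_space" and s :: "nat \<Rightarrow> 'a"
  assumes "surj \<psi>" and iso: "\<And>x y. dist (\<psi> x) (\<psi> y) = dist x y" and "Cauchy s"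
  shows "convergent s"
proof -
  have "Cauchy (\<lambda>n. \<psi> (s n))" using assms(3) by (simp add: Cauchy_def iso)
  then obtain l where "(\<lambda>n. \<psi> (s n)) \<longlonglongrightarrow> l" using Cauchy_convergent convergent_def by blast
  moreover obtain x where "l = \<psi> x" using assms(1) by (metis surjD)
  ultimately have "s \<longlonglongrightarrow> x" by (simp add: tendsto_iff iso)
  then show ?thesis by (auto simp: convergent_def)
qed

text \<open>
  With complete scalars the bounded linear maps into them form a Banach space, so that pointwise
  Cauchy sequences of maps into the dual have limits.
\<close>

instance rc_field \<subseteq> banach
proof
  fix s :: "nat \<Rightarrow> 'a"
  assume s: "Cauchy s"
  have iso: "dist (\<psi> x) (\<psi> y) = dist x y"
    if "\<And>x y. \<psi> (x + y) = \<psi> x + \<psi> y" "\<And>x. norm (\<psi> x) = norm x"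
    for \<psi> :: "'a \<Rightarrow> 'b::real_normed_vector" and x y
    using that(1)[of "x - y" y] that(2)[of "x - y"] by (simp add: dist_norm)
  show "convergent s"
    using real_or_complex
  proof (elim disjE exE conjE)
    fix \<psi> :: "'a \<Rightarrow> real"
    assume *: "bij \<psi>" "\<forall>x y. \<psi> (x + y) = \<psi> x + \<psi> y" "\<forall>x. norm (\<psi> x) = norm x"
    show ?thesis
      by (rule complete_space_isometry[OF bij_is_surj[OF *(1)] iso s]) (use * in auto)
  next
    fix \<psi> :: "'a \<Rightarrow> complex"
    assume *: "bij \<psi>" "\<forall>x y. \<psi> (x + y) = \<psi> x + \<psi> y" "\<forall>x. norm (\<psi> x) = norm x"
    show ?thesis
      by (rule complete_space_isometry[OF bij_is_surj[OF *(1)] iso s]) (use * in auto)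
  qed
qed


context banach_over
begin

lemma vector_space_mult_rc: "vector_space ((*) :: 'k \<Rightarrow> 'k \<Rightarrow> 'k)"
  by unfold_locales (auto simp: algebra_simps)

lemma mem_dual_iff: "\<phi> \<in> dual sc \<longleftrightarrow> (\<forall>c e. blinfun_apply \<phi> (sc c e) = c * blinfun_apply \<phi> e)"
  using vector_space_axioms vector_space_mult_rc
  by (auto simp: dual_def Vector_Spaces.linear_iff blinfun.add_right)

lemma dual_apply_sc: "\<phi> \<in> dual sc \<Longrightarrow> blinfun_apply \<phi> (sc c e) = c * blinfun_apply \<phi> e"
  by (simp add: mem_dual_iff)

lemma dual_zero: "0 \<in> dual sc"
  and dual_add: "\<phi> \<in> dual sc \<Longrightarrow> \<psi> \<in> dual sc \<Longrightarrow> \<phi> + \<psi> \<in> dual sc"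
  and dual_diff: "\<phi> \<in> dual sc \<Longrightarrow> \<psi> \<in> dual sc \<Longrightarrow> \<phi> - \<psi> \<in> dual sc"
  and dual_scale: "\<phi> \<in> dual sc \<Longrightarrow> dual_sc c \<phi> \<in> dual sc"
  by (auto simp: mem_dual_iff blinfun.add_left blinfun.diff_left algebra_simps)

text \<open>
  To bound \<open>f\<close> by the norm it suffices to look at real values: multiplying \<open>x\<close> by a scalar of
  modulus one leaves the norm of \<open>x\<close> unchanged and makes \<open>f x\<close> equal to its modulus.
\<close>

lemma dominated_functional_in_dual:
  fixes f :: "'e \<Rightarrow> 'k"
  assumes add: "\<And>x y. f (x + y) = f x + f y"
    and scale: "\<And>c x. f (sc c x) = c * f x"
    and dom: "\<And>x r. f x = of_real r \<Longrightarrow> r \<le> norm x"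
  obtains \<phi> where "\<phi> \<in> dual sc" "norm \<phi> \<le> 1" "\<And>x. blinfun_apply \<phi> x = f x"
proof -
  have bound: "norm (f x) \<le> norm x" for x
  proof (cases "f x = 0")
    case False
    define c where "c = of_real (norm (f x)) / f x"
    have "f (sc c x) = of_real (norm (f x))" using False by (simp add: scale c_def)
    then have "norm (f x) \<le> norm (sc c x)" by (rule dom)
    also have "\<dots> = norm x" using False by (simp add: norm_sc c_def norm_divide)
    finally show ?thesis .
  qed simp
  have "bounded_linear f"
  proof (rule bounded_linear_intro[of _ 1])
    show "f (r *\<^sub>R x) = r *\<^sub>R f x" for r x
      using scale[of "of_real r" x] by (simp add: sc_of_real scaleR_conv_of_real)
  qed (simp_all add: add bound)
  then have app: "blinfun_apply (Blinfun f) x = f x" for x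
    by (simp add: bounded_linear_Blinfun_apply)
  show thesis
  proof
    show "Blinfun f \<in> dual sc" by (simp add: mem_dual_iff app scale)
    show "norm (Blinfun f) \<le> 1" by (rule norm_blinfun_bound) (simp_all add: app bound)
  qed (rule app)
qed

text \<open>
  Over the complex scalars, a real functional \<open>u\<close> is the real part of exactly one linear
  functional, \<open>x \<mapsto> u x - u (\<i> x) \<i>\<close>.
\<close>

lemma norming_functional:
  obtains \<phi> where "\<phi> \<in> dual sc" "norm \<phi> \<le> 1" "norm a \<le> norm (blinfun_apply \<phi> a)"
proof -
  obtain u :: "'e \<Rightarrow> real" where u: "linear u" "\<And>x. u x \<le> norm x" "u a = norm a"
    using real_norming_functional[of a] by blast
  note u_add = linear_add[OF u(1)] and u_scale = linear_scale[OF u(1)]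
  show thesis
  proof (cases rule: rc_field_cases[where 'k = 'k])
    case real
    define f :: "'e \<Rightarrow> 'k" where "f x = of_real (u x)" for x
    have add: "f (x + y) = f x + f y" for x y
      by (simp add: f_def u_add)
    have scale: "f (sc c x) = c * f x" for c x
    proof -
      obtain r where "c = of_real r" using real by blast
      then show ?thesis by (simp add: f_def sc_of_real u_scale)
    qed
    have dom: "r \<le> norm x" if "f x = of_real r" for x r
      using that u(2)[of x] by (simp add: f_def)
    obtain \<phi> where \<phi>: "\<phi> \<in> dual sc" "norm \<phi> \<le> 1" "\<And>x. blinfun_apply \<phi> x = f x"
      using dominated_functional_in_dual[of f, OF add scale dom] by blast
    show thesis
      by (rule that[OF \<phi>(1,2)]) (simp add: \<phi>(3) f_def u(3))
  next
    case (complex j)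
    define f :: "'e \<Rightarrow> 'k" where "f x = of_real (u x) + of_real (- u (sc j x)) * j" for x
    have add: "f (x + y) = f x + f y" for x y
        by (simp add: f_def scale_right_distrib u_add algebra_simps)
    have scale: "f (sc c x) = c * f x" for c x
    proof -
      obtain s t where c: "c = of_real s + of_real t * j" using complex(2) by blast
      have jj: "sc j (sc j x) = - x"
        using sc_of_real[of "- 1" x] complex(1) by simp
      have cx: "sc c x = s *\<^sub>R x + t *\<^sub>R sc j x"
        using sc_of_real[of t "sc j x"]
        by (simp add: c scale_left_distrib sc_of_real del: scale_scale flip: scale_scale)
      have scR: "sc j (r *\<^sub>R z) = r *\<^sub>R sc j z" for r z
        by (metis mult.commute sc_of_real scale_scale)
      have jcx: "sc j (sc c x) = s *\<^sub>R sc j x - t *\<^sub>R x"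
        by (simp add: cx scale_right_distrib scR jj del: scale_scale)
      have m: "j * (j * z) = - z" for z
        using complex(1) by (simp flip: mult.assoc)
      show ?thesis
        unfolding f_def jcx unfolding cx
        by (simp add: c u_add u_scale linear_diff[OF u(1)] algebra_simps m complex(1))
    qed
    have dom: "r \<le> norm x" if "f x = of_real r" for x r
    proof -
      \<comment> \<open>The norm formula makes the decomposition into real and imaginary parts unique.\<close>
      have "of_real (u x - r) + of_real (- u (sc j x)) * j = 0"
        using that by (simp add: f_def algebra_simps)
      then have "(u x - r)\<^sup>2 + (- u (sc j x))\<^sup>2 = 0"
        using complex(3)[of "u x - r" "- u (sc j x)"] by simp
      then have "u x = r" by (simp add: sum_power2_eq_zero_iff)
      then show ?thesis using u(2) by auto
    qed
    obtain \<phi> where \<phi>: "\<phi> \<in> dual sc" "norm \<phi> \<le> 1" "\<And>x. blinfun_apply \<phi> x = f x"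
      using dominated_functional_in_dual[of f, OF add scale dom] by blast
    have "norm (f a) = sqrt ((u a)\<^sup>2 + (- u (sc j a))\<^sup>2)"
      unfolding f_def by (rule complex(3))
    also have "\<dots> \<ge> sqrt ((u a)\<^sup>2)" by simp
    finally have "norm a \<le> norm (f a)" by (simp add: u(3))
    then show thesis by (intro that[OF \<phi>(1,2)]) (simp add: \<phi>(3))
  qed
qed

lemma dual_separates:
  assumes "\<And>\<phi>. \<phi> \<in> dual sc \<Longrightarrow> blinfun_apply \<phi> a = blinfun_apply \<phi> b"
  shows "a = b"
proof -
  obtain \<phi> where \<phi>: "\<phi> \<in> dual sc" "norm (a - b) \<le> norm (blinfun_apply \<phi> (a - b))"
    by (rule norming_functional[of "a - b"])
  then show ?thesis using assms[OF \<phi>(1)] by (simp add: blinfun.diff_right)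
qed

section \<open>Adjoints of operators on the dual of a reflexive space\<close>

lemma bounded_linear_dual_opnorm:
  fixes S :: "('e \<Rightarrow>\<^sub>L 'k) \<Rightarrow> 'w::real_normed_vector"
  assumes "bounded_linear_dual sc scw S"
  shows opnorm_dual_nonneg: "0 \<le> opnorm_dual sc S"
    and norm_le_opnorm_dual: "\<phi> \<in> dual sc \<Longrightarrow> norm (S \<phi>) \<le> opnorm_dual sc S * norm \<phi>"
proof -
  define B where "B = {C. 0 \<le> C \<and> (\<forall>\<phi>\<in>dual sc. norm (S \<phi>) \<le> C * norm \<phi>)}"
  obtain C where C: "\<forall>\<phi>\<in>dual sc. norm (S \<phi>) \<le> C * norm \<phi>"
    using assms by (auto simp: bounded_linear_dual_def)
  have "norm (S \<phi>) \<le> max 0 C * norm \<phi>" if "\<phi> \<in> dual sc" for \<phi>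
    using C that by (intro order_trans[OF bspec[OF C that]] mult_right_mono) auto
  then have "max 0 C \<in> B" unfolding B_def mem_Collect_eq by (intro conjI ballI) simp_all
  then have B: "B \<noteq> {}" by blast
  have Inf: "opnorm_dual sc S = Inf B" by (simp add: opnorm_dual_def B_def)
  show "0 \<le> opnorm_dual sc S"
    unfolding Inf using B by (intro cInf_greatest) (auto simp: B_def)
  show "norm (S \<phi>) \<le> opnorm_dual sc S * norm \<phi>" if "\<phi> \<in> dual sc"
  proof (cases "norm \<phi> = 0")
    case True
    then show ?thesis using C that by auto
  next
    case False
    have "norm (S \<phi>) / norm \<phi> \<le> Inf B"
      using B False that by (intro cInf_greatest) (auto simp: B_def field_simps)
    then show ?thesis using False by (simp add: Inf field_simps)
  qed
qed

lemma bounded_linear_dual_diff: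
  assumes "bounded_linear_dual sc dual_sc S" "\<phi> \<in> dual sc" "\<psi> \<in> dual sc"
  shows "S (\<phi> - \<psi>) = S \<phi> - S \<psi>"
proof -
  have "S ((\<phi> - \<psi>) + \<psi>) = S (\<phi> - \<psi>) + S \<psi>"
    using assms dual_diff unfolding bounded_linear_dual_def by blast
  then show ?thesis by simp
qed

text \<open>
  Reflexivity represents \<open>\<phi> \<mapsto> S \<phi> e\<close> as evaluation at a point \<open>t e\<close>.  That \<open>t\<close> is linear holds
  because the dual separates points, and a norming functional for \<open>t e\<close> bounds \<open>t\<close> by the norm
  of \<open>S\<close>.
\<close>

lemma adjoint_exists:
  assumes refl: "reflexive sc" and S: "bounded_linear_dual sc dual_sc S"
    and S_dual: "S ` dual sc \<subseteq> dual sc"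
  obtains T :: "'e \<Rightarrow>\<^sub>L 'e" where "Vector_Spaces.linear sc sc (blinfun_apply T)"
    "norm T \<le> opnorm_dual sc S"
    "\<And>\<phi> e. \<phi> \<in> dual sc \<Longrightarrow> blinfun_apply \<phi> (blinfun_apply T e) = blinfun_apply (S \<phi>) e"
proof -
  have "\<exists>e'. \<forall>\<phi>\<in>dual sc. blinfun_apply (S \<phi>) e = blinfun_apply \<phi> e'" for e
  proof -
    have "norm (blinfun_apply (S \<phi>) e) \<le> (opnorm_dual sc S * norm e) * norm \<phi>"
      if "\<phi> \<in> dual sc" for \<phi>
    proof -
      have "norm (blinfun_apply (S \<phi>) e) \<le> norm (S \<phi>) * norm e" by (rule norm_blinfun)
      also have "\<dots> \<le> opnorm_dual sc S * norm \<phi> * norm e"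
        by (intro mult_right_mono norm_le_opnorm_dual[OF S that]) simp
      finally show ?thesis by (simp add: mult_ac)
    qed
    then have "bounded_linear_dual sc (*) (\<lambda>\<phi>. blinfun_apply (S \<phi>) e)"
      using S unfolding bounded_linear_dual_def by (auto simp: blinfun.add_left)
    then show ?thesis using refl unfolding reflexive_def by blast
  qed
  then obtain t where "\<forall>e. \<forall>\<phi>\<in>dual sc. blinfun_apply (S \<phi>) e = blinfun_apply \<phi> (t e)"
    by metis
  then have t: "blinfun_apply \<phi> (t e) = blinfun_apply (S \<phi>) e" if "\<phi> \<in> dual sc" for \<phi> e
    using that by simp
  have add: "t (e + e') = t e + t e'" for e e'
    by (rule dual_separates) (simp add: t blinfun.add_right)
  have scale: "t (sc c e) = sc c (t e)" for c e
  proof (rule dual_separates)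
    fix \<phi> assume \<phi>: "\<phi> \<in> dual sc"
    then have "S \<phi> \<in> dual sc" using S_dual by blast
    with \<phi> show "blinfun_apply \<phi> (t (sc c e)) = blinfun_apply \<phi> (sc c (t e))"
      by (simp add: t dual_apply_sc)
  qed
  have bound: "norm (t e) \<le> norm e * opnorm_dual sc S" for e
  proof -
    obtain \<phi> where \<phi>: "\<phi> \<in> dual sc" "norm \<phi> \<le> 1" "norm (t e) \<le> norm (blinfun_apply \<phi> (t e))"
      by (rule norming_functional)
    note \<phi>(3)
    also have "norm (blinfun_apply \<phi> (t e)) \<le> norm (S \<phi>) * norm e"
      by (simp add: t[OF \<phi>(1)] norm_blinfun)
    also have "\<dots> \<le> opnorm_dual sc S * norm \<phi> * norm e"
      by (intro mult_right_mono norm_le_opnorm_dual[OF S \<phi>(1)]) simp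
    also have "\<dots> \<le> opnorm_dual sc S * 1 * norm e"
      by (intro mult_right_mono mult_left_mono \<phi>(2) opnorm_dual_nonneg[OF S]) simp
    finally show ?thesis by (simp add: mult_ac)
  qed
  have "bounded_linear t"
  proof (rule bounded_linear_intro[OF add _ bound])
    show "t (r *\<^sub>R e) = r *\<^sub>R t e" for r e
      using scale[of "of_real r" e] by (simp add: sc_of_real)
  qed
  then have app: "blinfun_apply (Blinfun t) e = t e" for e
    by (simp add: bounded_linear_Blinfun_apply)
  show thesis
  proof
    show "Vector_Spaces.linear sc sc (blinfun_apply (Blinfun t))"
      using vector_space_axioms by (simp add: Vector_Spaces.linear_iff app add scale)
    show "norm (Blinfun t) \<le> opnorm_dual sc S"
      using bound by (intro norm_blinfun_bound opnorm_dual_nonneg[OF S]) (simp add: app mult.commute)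
  qed (simp add: app t)
qed

end

section \<open>The norm on the space of \<open>\<alpha>\<close>-Lipschitz operators\<close>

interpretation functional_vs: vector_space functional_sc
  by (rule vector_space_functional_sc)

interpretation dual_vs: vector_space dual_sc
  by (rule vector_space_dual_sc)

interpretation fun_vs: vector_space fun_sc
  by (rule vector_space_fun_sc)

lemma Lip_nonneg: "f \<in> lip0 x0 y0 \<Longrightarrow> 0 \<le> Lip f"
  unfolding Lip_def lip0_def by (intro cInf_greatest) (auto dest: lipschitz_on_nonneg)

lemma mult_divide_add_one_less:
  fixes a \<epsilon> :: real
  assumes "0 < \<epsilon>" "0 \<le> a"
  shows "a * (\<epsilon> / (a + 1)) < \<epsilon>"
proof -
  have "a * \<epsilon> < \<epsilon> * (a + 1)" using assms by (simp add: algebra_simps)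
  then show ?thesis using assms by (simp add: pos_divide_less_eq add_nonneg_pos)
qed

lemma norm_over_subset: "norm_over scv V N \<Longrightarrow> W \<subseteq> V \<Longrightarrow> norm_over scv W N"
  unfolding norm_over_def by (simp add: subset_iff)

locale lip_crossnormed = banach_over sc
  for sc :: "'k::rc_field \<Rightarrow> 'e::banach \<Rightarrow> 'e" +
  fixes x0 :: "'x::metric_space"
    and \<alpha> :: "('x, 'e, 'k) lip_functional \<Rightarrow> real"
  assumes crossnorm: "lip_crossnorm x0 sc \<alpha>"
begin

abbreviation "tensor n x y e \<equiv> (\<Sum>i<(n::nat). delta x0 sc (x i) (y i) (e i))"
abbreviation "pairing f n x y e \<equiv> (\<Sum>i<(n::nat). blinfun_apply (f (x i) - f (y i)) (e i))"
abbreviation "bnd \<equiv> alpha_bound x0 sc \<alpha>"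
abbreviation "ops \<equiv> Lip_alpha_ops x0 sc \<alpha>"
abbreviation "N \<equiv> Lip_alpha x0 sc \<alpha>"

lemma tensor_norm_nonneg: "0 \<le> \<alpha> (tensor n x y e)"
proof -
  have "tensor n x y e \<in> lip_tensor x0 sc"
    unfolding lip_tensor_def by (intro functional_vs.span_sum functional_vs.span_base) blast
  then show ?thesis using crossnorm by (auto simp: lip_crossnorm_def norm_over_def)
qed

lemma alpha_bound_nonneg: "bnd f C \<Longrightarrow> 0 \<le> C"
  by (simp add: alpha_bound_def)

lemma alpha_boundD: "bnd f C \<Longrightarrow> norm (pairing f n x y e) \<le> C * \<alpha> (tensor n x y e)"
  by (simp add: alpha_bound_def)

lemma alpha_bound_mono:
  assumes "bnd f C" "C \<le> D"
  shows "bnd f D"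
  unfolding alpha_bound_def
proof (intro conjI allI)
  show "norm (pairing f n x y e) \<le> D * \<alpha> (tensor n x y e)" for n x y e
    using alpha_boundD[OF assms(1)] mult_right_mono[OF assms(2) tensor_norm_nonneg]
    by (rule order_trans)
qed (use assms in \<open>auto dest: alpha_bound_nonneg\<close>)

lemma alpha_bound_zero: "bnd 0 0"
  by (simp add: alpha_bound_def)

lemma alpha_bound_add:
  assumes "bnd f C" "bnd g D"
  shows "bnd (f + g) (C + D)"
  unfolding alpha_bound_def
proof (intro conjI allI)
  fix n x y e
  have "pairing (f + g) n x y e = pairing f n x y e + pairing g n x y e"
    by (simp add: sum.distrib[symmetric] blinfun.diff_left blinfun.add_left algebra_simps)
  also have "norm \<dots> \<le> C * \<alpha> (tensor n x y e) + D * \<alpha> (tensor n x y e)"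
    by (intro norm_triangle_mono alpha_boundD assms)
  finally show "norm (pairing (f + g) n x y e) \<le> (C + D) * \<alpha> (tensor n x y e)"
    by (simp add: algebra_simps)
qed (use assms in \<open>simp add: alpha_bound_nonneg\<close>)

lemma alpha_bound_scale:
  assumes "bnd f C"
  shows "bnd (fun_sc c f) (norm c * C)"
  unfolding alpha_bound_def
proof (intro conjI allI)
  fix n x y e
  have "pairing (fun_sc c f) n x y e = c * pairing f n x y e"
    by (simp add: fun_sc_def sum_distrib_left blinfun.diff_left algebra_simps)
  then show "norm (pairing (fun_sc c f) n x y e) \<le> norm c * C * \<alpha> (tensor n x y e)"
    using alpha_boundD[OF assms, where n = n and x = x and y = y and e = e] by (simp add: norm_mult mult.assoc mult_left_mono)
qed (use assms in \<open>auto dest: alpha_bound_nonneg\<close>)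

text \<open>
  A single elementary tensor has norm \<open>dist x y * norm e\<close>, so an \<open>\<alpha>\<close>-bound is a Lipschitz
  constant for the operator norm.
\<close>

lemma alpha_bound_dist:
  assumes "bnd f C"
  shows "norm (f x - f y) \<le> C * dist x y"
proof (rule norm_blinfun_bound)
  show "norm (blinfun_apply (f x - f y) e) \<le> C * dist x y * norm e" for e
    using alpha_boundD[OF assms, where n = 1 and x = "\<lambda>_. x" and y = "\<lambda>_. y" and e = "\<lambda>_. e"] crossnorm
    by (simp add: lip_crossnorm_def mult.assoc)
qed (use assms in \<open>auto dest: alpha_bound_nonneg\<close>)

lemma Lip_alpha_opsD:
  assumes "f \<in> ops"
  shows "f x0 = 0" "f x \<in> dual sc"
  using assms by (auto simp: Lip_alpha_ops_def)

lemma Lip_alpha_opsI: "f x0 = 0 \<Longrightarrow> (\<And>x. f x \<in> dual sc) \<Longrightarrow> bnd f C \<Longrightarrow> f \<in> ops"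
  by (auto simp: Lip_alpha_ops_def)

lemma Lip_alpha_le: "bnd f C \<Longrightarrow> N f \<le> C"
  unfolding Lip_alpha_def by (rule cInf_lower) (auto intro!: bdd_belowI dest: alpha_bound_nonneg)

text \<open>
  The infimum in the definition of \<open>Lip_alpha\<close> is attained, as each defining inequality is closed
  in \<open>C\<close>.
\<close>

lemma alpha_bound_Lip_alpha:
  assumes "f \<in> ops"
  shows "bnd f (N f)"
proof -
  obtain C where C: "bnd f C" using assms by (auto simp: Lip_alpha_ops_def)
  show ?thesis
    unfolding alpha_bound_def
  proof (intro conjI allI)
    show "0 \<le> N f" unfolding Lip_alpha_def
      using C by (intro cInf_greatest) (auto dest: alpha_bound_nonneg)
    fix n x y e
    show "norm (pairing f n x y e) \<le> N f * \<alpha> (tensor n x y e)"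
    proof (cases "\<alpha> (tensor n x y e) = 0")
      case True
      then show ?thesis using alpha_boundD[OF C, where n = n and x = x and y = y and e = e] by simp
    next
      case False
      then have pos: "0 < \<alpha> (tensor n x y e)" using tensor_norm_nonneg[where n = n and x = x and y = y and e = e] by simp
      have "norm (pairing f n x y e) / \<alpha> (tensor n x y e) \<le> N f"
        unfolding Lip_alpha_def
      proof (rule cInf_greatest)
        fix D assume "D \<in> {C. bnd f C}"
        then have "norm (pairing f n x y e) \<le> D * \<alpha> (tensor n x y e)"
          by (intro alpha_boundD) simp
        then show "norm (pairing f n x y e) / \<alpha> (tensor n x y e) \<le> D"
          using pos by (simp add: field_simps)
      qed (use C in auto)
      then show ?thesis using pos by (simp add: field_simps)
    qed
  qed
qed

lemma Lip_alpha_nonneg: "f \<in> ops \<Longrightarrow> 0 \<le> N f"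
  by (rule alpha_bound_nonneg[OF alpha_bound_Lip_alpha])

lemma Lip_alpha_dist:
  assumes "f \<in> ops"
  shows "norm (f x) \<le> N f * dist x x0"
  using alpha_bound_dist[OF alpha_bound_Lip_alpha[OF assms], of x x0] assms by (simp add: Lip_alpha_opsD)

lemma ops_zero: "0 \<in> ops"
  by (rule Lip_alpha_opsI[OF _ _ alpha_bound_zero]) (simp_all add: dual_zero)

lemma ops_add: "f \<in> ops \<Longrightarrow> g \<in> ops \<Longrightarrow> f + g \<in> ops"
  by (rule Lip_alpha_opsI[OF _ _ alpha_bound_add[OF alpha_bound_Lip_alpha alpha_bound_Lip_alpha]])
    (simp_all add: dual_add Lip_alpha_opsD)

lemma ops_scale: "f \<in> ops \<Longrightarrow> fun_sc c f \<in> ops"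
  by (rule Lip_alpha_opsI[OF _ _ alpha_bound_scale[OF alpha_bound_Lip_alpha]])
    (simp_all add: dual_scale Lip_alpha_opsD fun_sc_def dual_vs.scale_zero_right)

lemma subspace_ops: "fun_vs.subspace ops"
  by (rule fun_vs.subspaceI) (auto intro: ops_zero ops_add ops_scale)

lemmas ops_diff = fun_vs.subspace_diff[OF subspace_ops]

lemma Lip_alpha_add: "f \<in> ops \<Longrightarrow> g \<in> ops \<Longrightarrow> N (f + g) \<le> N f + N g"
  by (intro Lip_alpha_le alpha_bound_add alpha_bound_Lip_alpha)

lemma Lip_alpha_scale:
  assumes "f \<in> ops"
  shows "N (fun_sc c f) = norm c * N f"
proof (rule antisym)
  show le: "N (fun_sc c f) \<le> norm c * N f"
    by (intro Lip_alpha_le alpha_bound_scale alpha_bound_Lip_alpha assms)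
  show "norm c * N f \<le> N (fun_sc c f)"
  proof (cases "c = 0")
    case True
    then show ?thesis using Lip_alpha_nonneg[OF ops_scale[OF assms, of c]] by simp
  next
    case False
    have "N (fun_sc (inverse c) (fun_sc c f)) \<le> norm (inverse c) * N (fun_sc c f)"
      by (intro Lip_alpha_le alpha_bound_scale alpha_bound_Lip_alpha ops_scale assms)
    then show ?thesis using False by (simp add: norm_divide divide_inverse[symmetric] field_simps)
  qed
qed

lemma Lip_alpha_diff_commute: "f \<in> ops \<Longrightarrow> g \<in> ops \<Longrightarrow> N (f - g) = N (g - f)"
  using Lip_alpha_scale[OF ops_diff[of g f], of "- 1"] by simp

lemma norm_over_ops: "norm_over fun_sc ops N"
proof -
  have "f = 0" if f: "f \<in> ops" "N f = 0" for f
  proof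
    show "f x = 0 x" for x using Lip_alpha_dist[OF f(1), of x] f(2) by simp
  qed
  moreover have "N 0 = 0"
    using Lip_alpha_le[OF alpha_bound_zero] Lip_alpha_nonneg[OF ops_zero] by simp
  ultimately show ?thesis
    using Lip_alpha_nonneg Lip_alpha_scale Lip_alpha_add by (auto simp: norm_over_def)
qed

lemma ops_subset_lip0_dual: "ops \<subseteq> lip0_dual x0 sc"
proof
  fix f assume f: "f \<in> ops"
  have "(N f)-lipschitz_on UNIV f"
    using alpha_bound_dist[OF alpha_bound_Lip_alpha[OF f]] Lip_alpha_nonneg[OF f]
    by (auto intro!: lipschitz_onI simp: dist_norm)
  then show "f \<in> lip0_dual x0 sc" using f by (auto simp: lip0_dual_def lip0_def Lip_alpha_opsD)
qed

text \<open>
  Completeness of the \<open>\<alpha>\<close>-Lipschitz operators.  The limit is taken pointwise, and letting \<open>n\<close> tend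
  to infinity in the inequality saying that \<open>\<epsilon>\<close> is an \<open>\<alpha>\<close>-bound for \<open>s m - s n\<close> shows that it is
  one for \<open>s m - f\<close>.
\<close>

lemma ops_limit:
  assumes s: "range s \<subseteq> ops" and cauchy: "\<forall>\<epsilon>>0. \<exists>M. \<forall>m\<ge>M. \<forall>n\<ge>M. N (s m - s n) < \<epsilon>"
  obtains f where "f \<in> ops" "(\<lambda>n. N (s n - f)) \<longlonglongrightarrow> 0"
proof -
  have s_ops: "s n \<in> ops" for n using s by auto
  have "convergent (\<lambda>n. s n x)" for x
  proof (rule Cauchy_convergent, rule CauchyI)
    fix \<epsilon> :: real assume "0 < \<epsilon>"
    then have "0 < \<epsilon> / (dist x x0 + 1)" by (intro divide_pos_pos add_nonneg_pos) auto
    then obtain M where M: "\<forall>m\<ge>M. \<forall>n\<ge>M. N (s m - s n) < \<epsilon> / (dist x x0 + 1)"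
      using cauchy by meson
    have "norm (s m x - s n x) < \<epsilon>" if "M \<le> m" "M \<le> n" for m n
    proof -
      have "norm ((s m - s n) x) \<le> N (s m - s n) * dist x x0"
        by (intro Lip_alpha_dist ops_diff s_ops)
      also have "\<dots> \<le> \<epsilon> / (dist x x0 + 1) * dist x x0"
        using M that by (intro mult_right_mono) (auto intro: less_imp_le)
      also have "\<dots> = dist x x0 * (\<epsilon> / (dist x x0 + 1))" by simp
      also have "\<dots> < \<epsilon>" using \<open>0 < \<epsilon>\<close> by (rule mult_divide_add_one_less) simp
      finally show ?thesis by simp
    qed
    then show "\<exists>M. \<forall>m\<ge>M. \<forall>n\<ge>M. norm (s m x - s n x) < \<epsilon>" by blast
  qed
  then obtain f where f: "(\<lambda>n. s n x) \<longlonglongrightarrow> f x" for x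
    unfolding convergent_def by metis
  have f0: "f x0 = 0"
    using f[of x0] s_ops by (simp add: Lip_alpha_opsD LIMSEQ_const_iff)
  have f_dual: "f x \<in> dual sc" for x
    unfolding mem_dual_iff
  proof (intro allI)
    fix c e
    have "(\<lambda>n. blinfun_apply (s n x) (sc c e)) \<longlonglongrightarrow> blinfun_apply (f x) (sc c e)"
      by (intro tendsto_intros f)
    moreover have "(\<lambda>n. c * blinfun_apply (s n x) e) \<longlonglongrightarrow> c * blinfun_apply (f x) e"
      by (intro tendsto_intros f)
    ultimately show "blinfun_apply (f x) (sc c e) = c * blinfun_apply (f x) e"
      using s_ops by (simp add: dual_apply_sc Lip_alpha_opsD LIMSEQ_unique)
  qed
  have bound: "\<exists>M. \<forall>m\<ge>M. bnd (s m - f) \<epsilon>" if "0 < \<epsilon>" for \<epsilon>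
  proof -
    obtain M where M: "\<forall>m\<ge>M. \<forall>n\<ge>M. N (s m - s n) < \<epsilon>" using cauchy \<open>0 < \<epsilon>\<close> by blast
    have "bnd (s m - f) \<epsilon>" if m: "M \<le> m" for m
      unfolding alpha_bound_def
    proof (intro conjI allI)
      fix k x y e
      have lim: "(\<lambda>n. norm (pairing (s m - s n) k x y e)) \<longlonglongrightarrow> norm (pairing (s m - f) k x y e)"
        unfolding minus_apply by (intro tendsto_intros f)
      have "norm (pairing (s m - s n) k x y e) \<le> \<epsilon> * \<alpha> (tensor k x y e)" if "M \<le> n" for n
      proof -
        have "bnd (s m - s n) (N (s m - s n))" by (intro alpha_bound_Lip_alpha ops_diff s_ops)
        then have "bnd (s m - s n) \<epsilon>"
          by (rule alpha_bound_mono) (use M m that in \<open>auto intro: less_imp_le\<close>)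
        then show ?thesis by (rule alpha_boundD)
      qed
      then show "norm (pairing (s m - f) k x y e) \<le> \<epsilon> * \<alpha> (tensor k x y e)"
        by (intro LIMSEQ_le_const2[OF lim]) blast
    qed (use \<open>0 < \<epsilon>\<close> in simp)
    then show ?thesis by blast
  qed
  obtain m where "bnd (s m - f) 1" using bound[of 1] by auto
  then have "s m - f \<in> ops"
    using f0 f_dual s_ops by (intro Lip_alpha_opsI) (auto simp: Lip_alpha_opsD dual_diff)
  then have f_ops: "f \<in> ops" using ops_diff[OF s_ops[of m], of "s m - f"] by simp
  have "(\<lambda>n. N (s n - f)) \<longlonglongrightarrow> 0"
  proof (rule LIMSEQ_I)
    fix \<epsilon> :: real assume "0 < \<epsilon>"
    then obtain M where "\<forall>m\<ge>M. bnd (s m - f) (\<epsilon> / 2)" using bound[of "\<epsilon> / 2"] by auto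
    then have "\<forall>m\<ge>M. N (s m - f) \<le> \<epsilon> / 2" using Lip_alpha_le by blast
    moreover have "0 \<le> N (s m - f)" for m by (intro Lip_alpha_nonneg ops_diff s_ops f_ops)
    ultimately show "\<exists>M. \<forall>m\<ge>M. norm (N (s m - f) - 0) < \<epsilon>"
      using \<open>0 < \<epsilon>\<close> by (intro exI[of _ M]) fastforce
  qed
  with f_ops show thesis by (rule that)
qed

section \<open>Approximable operators\<close>

abbreviation "F \<equiv> lip0F x0 sc \<inter> ops"
abbreviation "A \<equiv> Lip_alpha_approximable x0 sc \<alpha>"

lemma lip0FI:
  assumes f: "f \<in> ops" and B: "finite B" "range f \<subseteq> dual_vs.span B"
  shows "f \<in> F"
proof -
  obtain B' where B': "B' \<subseteq> range f" "dual_vs.independent B'" "range f \<subseteq> dual_vs.span B'"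
    by (rule dual_vs.maximal_independent_subset)
  have "finite B'"
    using dual_vs.independent_span_bound[OF B(1) B'(2)] B' B(2) by blast
  moreover have "dual_vs.span (range f) = dual_vs.span B'"
    using B' by (intro antisym dual_vs.span_mono dual_vs.span_minimal) auto
  ultimately have "f \<in> lip0F x0 sc"
    using f ops_subset_lip0_dual unfolding lip0F_def by blast
  with f show ?thesis by simp
qed

text \<open>
  Having the spanning set inside the range of \<open>f\<close>, hence inside the dual, matters because the
  operators composed with \<open>f\<close> are linear on the dual only.
\<close>

lemma lip0FE:
  assumes "f \<in> F"
  obtains B where "finite B" "B \<subseteq> range f" "range f \<subseteq> dual_vs.span B"
proof -
  obtain C where C: "finite C" "dual_vs.span (range f) = dual_vs.span C"
    using assms by (auto simp: lip0F_def)
  obtain B where B: "B \<subseteq> range f" "dual_vs.independent B" "range f \<subseteq> dual_vs.span B"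
    by (rule dual_vs.maximal_independent_subset)
  have "B \<subseteq> dual_vs.span C" using B(1) dual_vs.span_superset C(2) by blast
  then have "finite B" using dual_vs.independent_span_bound[OF C(1) B(2)] by blast
  with B show thesis by (intro that)
qed

lemma subspace_lip0F: "fun_vs.subspace F"
proof (rule fun_vs.subspaceI)
  show "0 \<in> F" by (rule lip0FI[OF ops_zero, of "{}"]) auto
next
  fix f g assume fg: "f \<in> F" "g \<in> F"
  obtain B where B: "finite B" "range f \<subseteq> dual_vs.span B" using fg(1) by (rule lip0FE)
  obtain C where C: "finite C" "range g \<subseteq> dual_vs.span C" using fg(2) by (rule lip0FE)
  have "range f \<subseteq> dual_vs.span (B \<union> C)" "range g \<subseteq> dual_vs.span (B \<union> C)"
    using B(2) C(2) dual_vs.span_mono[of B "B \<union> C"] dual_vs.span_mono[of C "B \<union> C"] by blast+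
  then have "range (f + g) \<subseteq> dual_vs.span (B \<union> C)"
    by (auto intro!: dual_vs.span_add)
  then show "f + g \<in> F" using fg B(1) C(1) by (intro lip0FI[of _ "B \<union> C"] ops_add) auto
next
  fix c f assume f: "f \<in> F"
  obtain B where B: "finite B" "range f \<subseteq> dual_vs.span B" using f by (rule lip0FE)
  then have "range (fun_sc c f) \<subseteq> dual_vs.span B"
    by (auto simp: fun_sc_def intro!: dual_vs.span_scale)
  then show "fun_sc c f \<in> F" using f B(1) by (intro lip0FI[of _ B] ops_scale) auto
qed

lemma approximableI:
  assumes "f \<in> ops" "\<And>\<epsilon>. 0 < \<epsilon> \<Longrightarrow> \<exists>g\<in>F. N (f - g) < \<epsilon>"
  shows "f \<in> A"
  using assms by (auto simp: Lip_alpha_approximable_def)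

lemma approximable_ops: "f \<in> A \<Longrightarrow> f \<in> ops"
  by (simp add: Lip_alpha_approximable_def)

lemma approximableE:
  assumes "f \<in> A" "0 < \<epsilon>"
  obtains g where "g \<in> F" "N (f - g) < \<epsilon>"
  using assms by (auto simp: Lip_alpha_approximable_def)

lemma lip0F_approximable:
  assumes "f \<in> F"
  shows "f \<in> A"
proof (rule approximableI)
  have "N (f - f) = 0" using norm_over_ops ops_zero by (simp add: norm_over_def)
  then show "\<exists>g\<in>F. N (f - g) < \<epsilon>" if "0 < \<epsilon>" for \<epsilon>
    using assms that by (metis)
qed (use assms in simp)

lemma approximable_closed:
  assumes f: "f \<in> ops" and "\<And>\<epsilon>. 0 < \<epsilon> \<Longrightarrow> \<exists>g\<in>A. N (f - g) < \<epsilon>"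
  shows "f \<in> A"
proof (rule approximableI[OF f])
  fix \<epsilon> :: real assume "0 < \<epsilon>"
  then have "0 < \<epsilon> / 2" by simp
  then obtain g where g: "g \<in> A" "N (f - g) < \<epsilon> / 2" using assms(2) by blast
  obtain k where k: "k \<in> F" "N (g - k) < \<epsilon> / 2" using g(1) \<open>0 < \<epsilon> / 2\<close> by (rule approximableE)
  have "N ((f - g) + (g - k)) \<le> N (f - g) + N (g - k)"
    using f g(1) k(1) by (intro Lip_alpha_add ops_diff) (auto simp: approximable_ops)
  with g(2) k show "\<exists>g\<in>F. N (f - g) < \<epsilon>" by (intro bexI[of _ k]) auto
qed

lemma subspace_approximable: "fun_vs.subspace A"
proof (rule fun_vs.subspaceI)
  show "0 \<in> A" by (intro lip0F_approximable fun_vs.subspace_0 subspace_lip0F)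
next
  fix f g assume fg: "f \<in> A" "g \<in> A"
  show "f + g \<in> A"
  proof (rule approximableI)
    fix \<epsilon> :: real assume "0 < \<epsilon>"
    then have "0 < \<epsilon> / 2" by simp
    obtain h where h: "h \<in> F" "N (f - h) < \<epsilon> / 2" using fg(1) \<open>0 < \<epsilon> / 2\<close> by (rule approximableE)
    obtain k where k: "k \<in> F" "N (g - k) < \<epsilon> / 2" using fg(2) \<open>0 < \<epsilon> / 2\<close> by (rule approximableE)
    have "N ((f - h) + (g - k)) \<le> N (f - h) + N (g - k)"
      using fg h(1) k(1) by (intro Lip_alpha_add ops_diff) (auto simp: approximable_ops)
    moreover have "(f - h) + (g - k) = (f + g) - (h + k)" by simp
    moreover have "h + k \<in> F" by (intro fun_vs.subspace_add[OF subspace_lip0F] h(1) k(1))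
    ultimately show "\<exists>g'\<in>F. N (f + g - g') < \<epsilon>" using h(2) k(2) by (intro bexI[of _ "h + k"]) auto
  qed (use fg in \<open>auto intro: ops_add approximable_ops\<close>)
next
  fix c f assume f: "f \<in> A"
  show "fun_sc c f \<in> A"
  proof (rule approximableI)
    fix \<epsilon> :: real assume "0 < \<epsilon>"
    then have "0 < \<epsilon> / (norm c + 1)" by (intro divide_pos_pos add_nonneg_pos) auto
    with f obtain g where g: "g \<in> F" "N (f - g) < \<epsilon> / (norm c + 1)" by (rule approximableE)
    have "N (fun_sc c f - fun_sc c g) = norm c * N (f - g)"
      unfolding fun_vs.scale_right_diff_distrib[symmetric]
      using f g(1) by (intro Lip_alpha_scale ops_diff) (auto simp: approximable_ops)
    also have "\<dots> \<le> norm c * (\<epsilon> / (norm c + 1))" using g(2) by (intro mult_left_mono) auto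
    also have "\<dots> < \<epsilon>" using \<open>0 < \<epsilon>\<close> by (rule mult_divide_add_one_less) simp
    finally show "\<exists>g\<in>F. N (fun_sc c f - g) < \<epsilon>"
      using fun_vs.subspace_scale[OF subspace_lip0F g(1)] by blast
  qed (use f in \<open>auto intro: ops_scale approximable_ops\<close>)
qed

lemma complete_norm_approximable: "complete_norm A N"
  unfolding complete_norm_def
proof (intro allI impI, elim conjE)
  fix s :: "nat \<Rightarrow> 'x \<Rightarrow> 'e \<Rightarrow>\<^sub>L 'k"
  assume s: "range s \<subseteq> A" and cauchy: "\<forall>\<epsilon>>0. \<exists>M. \<forall>m\<ge>M. \<forall>n\<ge>M. N (s m - s n) < \<epsilon>"
  then have s_ops: "range s \<subseteq> ops" using approximable_ops by blast
  obtain f where f: "f \<in> ops" "(\<lambda>n. N (s n - f)) \<longlonglongrightarrow> 0"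
    using s_ops cauchy by (rule ops_limit)
  have "f \<in> A"
  proof (rule approximable_closed[OF f(1)])
    fix \<epsilon> :: real assume "0 < \<epsilon>"
    then obtain n where "N (s n - f) < \<epsilon>"
      using order_tendstoD(2)[OF f(2)] by (auto simp: eventually_sequentially)
    moreover have "s n \<in> A" using s by blast
    ultimately show "\<exists>g\<in>A. N (f - g) < \<epsilon>"
      using Lip_alpha_diff_commute[OF f(1) approximable_ops] by auto
  qed
  with f(2) show "\<exists>v\<in>A. (\<lambda>n. N (s n - v)) \<longlonglongrightarrow> 0" by blast
qed

lemma rank_one_approximable:
  assumes dual: "dualizable x0 sc \<alpha>" and g: "g \<in> lip0 x0 (0::'k)" and \<phi>: "\<phi> \<in> dual sc"
  shows "(\<lambda>x. dual_sc (g x) \<phi>) \<in> A" "N (\<lambda>x. dual_sc (g x) \<phi>) \<le> Lip g * norm \<phi>"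
proof -
  let ?f = "\<lambda>x. dual_sc (g x) \<phi>"
  have bound: "bnd ?f (Lip g * norm \<phi>)"
    using dual g \<phi> Lip_nonneg[OF g]
    by (auto simp: alpha_bound_def dualizable_def blinfun.diff_left algebra_simps)
  have ops: "?f \<in> ops"
    using g \<phi> by (intro Lip_alpha_opsI[OF _ _ bound]) (auto simp: lip0_def dual_scale)
  have "range ?f \<subseteq> dual_vs.span {\<phi>}"
    by (auto intro: dual_vs.span_scale dual_vs.span_base)
  then have "?f \<in> F" by (rule lip0FI[OF ops, rotated]) simp
  then show "?f \<in> A" by (rule lip0F_approximable)
  show "N ?f \<le> Lip g * norm \<phi>" using bound by (rule Lip_alpha_le)
qed

text \<open>
  Passing from \<open>S\<close> to its pre-adjoint \<open>T\<close> moves the composition from the operator to the tensor,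
  where uniformity of \<open>\<alpha>\<close> applies.
\<close>

lemma alpha_bound_comp:
  assumes refl: "reflexive sc" and unif: "uniform x0 sc \<alpha>"
    and S: "bounded_linear_dual sc dual_sc S" "S ` dual sc \<subseteq> dual sc"
    and h: "h \<in> lip0 x0 x0" and f: "\<And>x. f x \<in> dual sc" "bnd f C"
  shows "bnd (S \<circ> f \<circ> h) (opnorm_dual sc S * C * Lip h)"
  unfolding alpha_bound_def
proof (intro conjI allI)
  show "0 \<le> opnorm_dual sc S * C * Lip h"
    by (intro mult_nonneg_nonneg opnorm_dual_nonneg[OF S(1)] alpha_bound_nonneg[OF f(2)] Lip_nonneg[OF h])
  obtain T :: "'e \<Rightarrow>\<^sub>L 'e" where T: "Vector_Spaces.linear sc sc (blinfun_apply T)"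
    "norm T \<le> opnorm_dual sc S"
    "\<And>\<phi> e. \<phi> \<in> dual sc \<Longrightarrow> blinfun_apply \<phi> (blinfun_apply T e) = blinfun_apply (S \<phi>) e"
    using refl S by (rule adjoint_exists) blast
  fix n x y e
  have "pairing (S \<circ> f \<circ> h) n x y e = pairing f n (h \<circ> x) (h \<circ> y) (blinfun_apply T \<circ> e)"
    by (simp add: T(3) f(1) dual_diff bounded_linear_dual_diff[OF S(1), symmetric])
  also have "norm \<dots> \<le> C * \<alpha> (tensor n (h \<circ> x) (h \<circ> y) (blinfun_apply T \<circ> e))"
    by (rule alpha_boundD[OF f(2)])
  also have "\<dots> \<le> C * (Lip h * norm T * \<alpha> (tensor n x y e))"
    using unif h T(1) alpha_bound_nonneg[OF f(2)]
    by (intro mult_left_mono) (auto simp: uniform_def)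
  also have "\<dots> \<le> C * (Lip h * opnorm_dual sc S * \<alpha> (tensor n x y e))"
    by (intro mult_left_mono mult_right_mono T(2) tensor_norm_nonneg Lip_nonneg[OF h]
        alpha_bound_nonneg[OF f(2)])
  finally show "norm (pairing (S \<circ> f \<circ> h) n x y e)
      \<le> opnorm_dual sc S * C * Lip h * \<alpha> (tensor n x y e)"
    by (simp add: mult_ac)
qed

lemma span_image_dual:
  assumes S: "bounded_linear_dual sc dual_sc S" and B: "B \<subseteq> dual sc" and \<phi>: "\<phi> \<in> dual_vs.span B"
  shows "\<phi> \<in> dual sc \<and> S \<phi> \<in> dual_vs.span (S ` B)"
  using \<phi>
proof (induction rule: dual_vs.span_induct_alt)
  case base
  have "S 0 = 0" using bounded_linear_dual_diff[OF S dual_zero dual_zero] by simp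
  then show ?case by (simp add: dual_zero dual_vs.span_zero)
next
  case (step c \<psi> \<theta>)
  then have \<psi>: "\<psi> \<in> dual sc" using B by blast
  have "S (dual_sc c \<psi> + \<theta>) = dual_sc c (S \<psi>) + S \<theta>"
    using S \<psi> step dual_scale[OF \<psi>] by (simp add: bounded_linear_dual_def)
  moreover have "dual_sc c (S \<psi>) + S \<theta> \<in> dual_vs.span (S ` B)"
    using step dual_vs.span_base[of "S \<psi>" "S ` B"]
    by (intro dual_vs.span_add dual_vs.span_scale) auto
  ultimately show ?case
    using step \<psi> by (simp add: dual_add dual_scale)
qed

lemma comp_approximable:
  assumes refl: "reflexive sc" and unif: "uniform x0 sc \<alpha>"
    and S: "bounded_linear_dual sc dual_sc S" "S ` dual sc \<subseteq> dual sc"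
    and h: "h \<in> lip0 x0 x0" and f: "f \<in> A"
  shows "S \<circ> f \<circ> h \<in> A" "N (S \<circ> f \<circ> h) \<le> opnorm_dual sc S * N f * Lip h"
proof -
  have h0: "h x0 = x0" using h by (simp add: lip0_def)
  have S0: "S 0 = 0" using bounded_linear_dual_diff[OF S(1) dual_zero dual_zero] by simp
  have bound: "bnd (S \<circ> k \<circ> h) (opnorm_dual sc S * N k * Lip h)" if "k \<in> ops" for k
    using that by (intro alpha_bound_comp assms alpha_bound_Lip_alpha Lip_alpha_opsD)
  have comp_ops: "S \<circ> k \<circ> h \<in> ops" if "k \<in> ops" for k
    using that S(2) by (intro Lip_alpha_opsI[OF _ _ bound[OF that]]) (auto simp: h0 S0 Lip_alpha_opsD)
  have comp_F: "S \<circ> k \<circ> h \<in> F" if k: "k \<in> F" for k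
  proof -
    have k_ops: "k \<in> ops" using k by simp
    obtain B where B: "finite B" "B \<subseteq> range k" "range k \<subseteq> dual_vs.span B"
      using k by (rule lip0FE)
    have "B \<subseteq> dual sc" using B(2) k_ops by (auto simp: Lip_alpha_opsD)
    then have "range (S \<circ> k \<circ> h) \<subseteq> dual_vs.span (S ` B)"
      using span_image_dual[OF S(1) \<open>B \<subseteq> dual sc\<close>] B(3) by fastforce
    then show ?thesis using B(1) by (intro lip0FI[OF comp_ops[OF k_ops], of "S ` B"]) auto
  qed
  have f_ops: "f \<in> ops" using f by (rule approximable_ops)
  show "N (S \<circ> f \<circ> h) \<le> opnorm_dual sc S * N f * Lip h"
    by (rule Lip_alpha_le[OF bound[OF f_ops]])
  show "S \<circ> f \<circ> h \<in> A"
  proof (rule approximableI[OF comp_ops[OF f_ops]])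
    fix \<epsilon> :: real assume "0 < \<epsilon>"
    define L where "L = opnorm_dual sc S * Lip h"
    have L: "0 \<le> L" unfolding L_def by (intro mult_nonneg_nonneg opnorm_dual_nonneg[OF S(1)] Lip_nonneg[OF h])
    with \<open>0 < \<epsilon>\<close> have "0 < \<epsilon> / (L + 1)" by (intro divide_pos_pos add_nonneg_pos) auto
    with f obtain g where g: "g \<in> F" "N (f - g) < \<epsilon> / (L + 1)" by (rule approximableE)
    then have g_ops: "g \<in> ops" by simp
    have "(S \<circ> f \<circ> h) - (S \<circ> g \<circ> h) = S \<circ> (f - g) \<circ> h"
      by (rule ext) (simp add: Lip_alpha_opsD[OF f_ops] Lip_alpha_opsD[OF g_ops]
          bounded_linear_dual_diff[OF S(1)])
    then have "N ((S \<circ> f \<circ> h) - (S \<circ> g \<circ> h)) \<le> L * N (f - g)"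
      using Lip_alpha_le[OF bound[OF ops_diff[OF f_ops g_ops]]] by (simp add: L_def mult_ac)
    also have "\<dots> \<le> L * (\<epsilon> / (L + 1))" using g(2) L by (intro mult_left_mono) auto
    also have "\<dots> < \<epsilon>" using \<open>0 < \<epsilon>\<close> L by (rule mult_divide_add_one_less)
    finally show "\<exists>g\<in>F. N ((S \<circ> f \<circ> h) - g) < \<epsilon>" using comp_F[OF g(1)] by blast
  qed
qed

end

section \<open>The Banach ideal of approximable operators\<close>

theorem theorem5p4:
  fixes x0 :: "'x::metric_space"
    and sc :: "'k::rc_field \<Rightarrow> 'e::banach \<Rightarrow> 'e"
    and \<alpha> :: "('x, 'e, 'k) lip_functional \<Rightarrow> real"
  assumes "banach_over sc"
    and "reflexive sc"
    and "lip_crossnorm x0 sc \<alpha>"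
    and "uniform x0 sc \<alpha>"
    and "dualizable x0 sc \<alpha>"
  shows "lip_operator_banach_ideal x0 sc (Lip_alpha_approximable x0 sc \<alpha>) (Lip_alpha x0 sc \<alpha>)"
proof -
  interpret lip_crossnormed sc x0 \<alpha>
    using assms(1,3) by (simp add: lip_crossnormed_def lip_crossnormed_axioms_def)
  have A: "A \<subseteq> ops" using approximable_ops by blast
  show ?thesis
    unfolding lip_operator_banach_ideal_def
  proof (intro conjI ballI allI impI; (elim conjE)?)
    show "A \<subseteq> lip0_dual x0 sc" using A ops_subset_lip0_dual by (rule order_trans)
    show "norm_over fun_sc A N" using norm_over_ops A by (rule norm_over_subset)
  qed (rule subspace_approximable complete_norm_approximable
      rank_one_approximable[OF assms(5)] comp_approximable[OF assms(2,4)]; assumption)+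
qed

end
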